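(* Let $K$ be a field and let $P=K[x_1,\dots,x_n]$ be non-negatively $\mathbb{Z}$-graded by $W\in\mathrm{Mat}_{1,n}(\mathbb{Z})$. Let $g_1,\dots,g_r\in P$ be $W$-homogeneous of positive $W$-degree, and let $I=\langle g_1,\dots,g_r\rangle$. For $i\in\{1,\dots,n\}$, let $\{g_{j_1},\dots,g_{j_t}\}$ be the set of all those generators $g_j$ with $\deg_W(g_j)=\deg_W(x_i)$, and for $k=1,\dots,t$ write $g_{j_k}=c_k\,x_i+h_k$ with $c_k\in P_0$ and $h_k\in P$ such that $x_i$ divides no term in the support of $h_k$. Then $I$ contains an $x_i$-separating $W$-homogeneous polynomial if and only if $1\in\langle c_1,\dots,c_t\rangle_{P_0}$. Consequently, the tuple $Z$ obtained by collecting all $x_i$ with $1\in\langle c_1,\dots,c_t\rangle_{P_0}$ (for $i=1,\dots,n$) is the tuple of all indeterminates $x_i$ for which an $x_i$-separating $W$-homogeneous polynomial exists in $I$.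
   Context: Grading: $W=(w_1,\dots,w_n)$ defines the $\mathbb{Z}$-grading on $P$ with $\deg_W(x_i)=w_i$; it is non-negative if all $w_i\ge 0$. $P_0$ is the degree-$0$ component, i.e. the polynomial ring over $K$ in the indeterminates of $W$-degree $0$; $\langle c_1,\dots,c_t\rangle_{P_0}$ is the ideal of $P_0$ generated by $c_1,\dots,c_t$ (the zero ideal if $t=0$). A polynomial $f\in P$ is $x_i$-separating if $f=x_i-h$ with a polynomial $h$ such that $x_i$ divides no term in the support of $h$ (the set of power products occurring in $h$ with nonzero coefficient). *)

theory Defs
  imports "HOL-Library.Poly_Mapping" "HOL-Algebra.Algebraic_Closure_Type"
begin

text \<open>
  A power product in the indeterminates indexed by the finite type \<open>'n\<close> is its exponent vector
  of type \<open>'n \<Rightarrow>\<^sub>0 nat\<close>, and the ring \<open>P = K[x_1, ..., x_n]\<close>, with \<open>n = CARD('n)\<close>, is the type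
  of finitely supported maps from power products to coefficients.
\<close>

type_synonym ('n, 'k) mpoly = "('n \<Rightarrow>\<^sub>0 nat) \<Rightarrow>\<^sub>0 'k"

definition indet :: "'n \<Rightarrow> ('n, 'k::comm_ring_1) mpoly" where
  "indet i = Poly_Mapping.single (Poly_Mapping.single i 1) 1"

definition wdeg :: "('n::finite \<Rightarrow> int) \<Rightarrow> ('n \<Rightarrow>\<^sub>0 nat) \<Rightarrow> int" where
  "wdeg W t = (\<Sum>i\<in>UNIV. W i * int (Poly_Mapping.lookup t i))"

text \<open>The zero polynomial is homogeneous of every degree.\<close>

definition homog_component :: "('n::finite \<Rightarrow> int) \<Rightarrow> int \<Rightarrow> ('n, 'k::comm_ring_1) mpoly set" where
  "homog_component W d = {f. \<forall>t\<in>Poly_Mapping.keys f. wdeg W t = d}"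

definition homogeneous :: "('n::finite \<Rightarrow> int) \<Rightarrow> ('n, 'k::comm_ring_1) mpoly \<Rightarrow> bool" where
  "homogeneous W f \<longleftrightarrow> (\<exists>d. f \<in> homog_component W d)"

definition indet_free :: "'n \<Rightarrow> ('n, 'k::comm_ring_1) mpoly \<Rightarrow> bool" where
  "indet_free i h \<longleftrightarrow>
    (\<forall>t\<in>Poly_Mapping.keys h. \<not> (indet i :: ('n, 'k) mpoly) dvd Poly_Mapping.single t 1)"

definition separating :: "'n \<Rightarrow> ('n, 'k::comm_ring_1) mpoly \<Rightarrow> bool" where
  "separating i f \<longleftrightarrow> (\<exists>h. indet_free i h \<and> f = indet i - h)"

definition mpoly_ring :: "('n, 'k::comm_ring_1) mpoly ring" where
  "mpoly_ring = ring_of_type_algebra"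

definition degree_zero_ring :: "('n::finite \<Rightarrow> int) \<Rightarrow> ('n, 'k::comm_ring_1) mpoly ring" where
  "degree_zero_ring W = mpoly_ring\<lparr>carrier := homog_component W 0\<rparr>"

definition is_decomposition ::
  "('n::finite \<Rightarrow> int) \<Rightarrow> 'n \<Rightarrow> ('n, 'k::comm_ring_1) mpoly \<Rightarrow> ('n, 'k) mpoly \<Rightarrow> ('n, 'k) mpoly \<Rightarrow> bool" where
  "is_decomposition W i f c h \<longleftrightarrow>
    c \<in> homog_component W 0 \<and> indet_free i h \<and> f = c * indet i + h"

end

theory Submission
  imports Defs
begin

text \<open>
  Let \<open>\<phi> f\<close> be the coefficient in \<open>P_0\<close> of \<open>x_i\<close> in \<open>f\<close>, that is, the sum of the \<open>a s\<close> over the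
  terms \<open>a s x_i\<close> of \<open>f\<close> with \<open>deg_W s = 0\<close>. If \<open>g\<close> has no term of degree zero, then
  \<open>\<phi> (q g) = q_0 \<phi> g\<close>, where \<open>q_0\<close> is the degree-zero part of \<open>q\<close>: by non-negativity a product
  of two terms can have the form \<open>s x_i\<close> only if \<open>x_i\<close> comes from \<open>g\<close> and the term from \<open>q\<close>
  has degree zero. Hence \<open>\<phi>\<close> maps \<open>I\<close> into the ideal of the \<open>c_k\<close>, and it maps an
  \<open>x_i\<close>-separating polynomial to \<open>1\<close>. Conversely, a relation \<open>\<Sum> q_k c_k = 1\<close> over \<open>P_0\<close> turns
  \<open>\<Sum> q_k g_k\<close> into a homogeneous separating polynomial, since for \<open>deg_W x_i > 0\<close> the elements
  of \<open>P_0\<close> do not involve \<open>x_i\<close>.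
\<close>

subsection \<open>Ideals of subrings of a ring given by a type\<close>

text \<open>The ring laws are inherited from the type, so only closure of \<open>C\<close> matters.
  \<open>C = UNIV\<close> gives P, and the degree-zero component gives P_0.\<close>

lemma ring_restrict_carrier:
  fixes C :: "'a::comm_ring_1 set"
  assumes "0 \<in> C" "1 \<in> C" "\<And>x y. x \<in> C \<Longrightarrow> y \<in> C \<Longrightarrow> x + y \<in> C"
    "\<And>x y. x \<in> C \<Longrightarrow> y \<in> C \<Longrightarrow> x * y \<in> C" "\<And>x. x \<in> C \<Longrightarrow> - x \<in> C"
  shows "ring (ring_of_type_algebra\<lparr>carrier := C\<rparr>)"
proof (rule ringI)
  show "abelian_group (ring_of_type_algebra\<lparr>carrier := C\<rparr>)"
    by (rule abelian_groupI)
      (use assms in \<open>auto simp: ring_of_type_algebra_def algebra_simps intro!: bexI[of _ "- x" for x]\<close>)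
  show "Group.monoid (ring_of_type_algebra\<lparr>carrier := C\<rparr>)"
    by (rule monoidI) (use assms in \<open>auto simp: ring_of_type_algebra_def algebra_simps\<close>)
qed (auto simp: ring_of_type_algebra_def algebra_simps)

text \<open>Since \<open>- 1\<close> lies in \<open>C\<close>, absorption already supplies additive
  inverses. Sets shown to be ideals this way contain a generated ideal once they contain its
  generators.\<close>

lemma ideal_restrict_carrierI:
  fixes C M :: "'a::comm_ring_1 set"
  assumes R: "ring (ring_of_type_algebra\<lparr>carrier := C\<rparr>)"
    and neg: "- 1 \<in> C"
    and M: "M \<subseteq> C" "0 \<in> M" "\<And>x y. x \<in> M \<Longrightarrow> y \<in> M \<Longrightarrow> x + y \<in> M"
      "\<And>q x. q \<in> C \<Longrightarrow> x \<in> M \<Longrightarrow> q * x \<in> M"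
  shows "ideal M (ring_of_type_algebra\<lparr>carrier := C\<rparr>)"
proof (rule idealI[OF R])
  interpret ring "ring_of_type_algebra\<lparr>carrier := C\<rparr>" by (rule R)
  have M': "x * q \<in> M" if "q \<in> C" "x \<in> M" for q x
    using M(4)[OF that] by (simp add: mult.commute)
  show "subgroup M (add_monoid (ring_of_type_algebra\<lparr>carrier := C\<rparr>))"
  proof (rule add.subgroupI)
    fix a assume a: "a \<in> M"
    have "- a \<in> M" using M(4)[OF neg a] by simp
    moreover have "\<ominus>\<^bsub>ring_of_type_algebra\<lparr>carrier := C\<rparr>\<^esub> a = - a"
      by (rule minus_equality) (use a \<open>- a \<in> M\<close> M in \<open>auto simp: ring_of_type_algebra_def\<close>)
    ultimately show "\<ominus>\<^bsub>ring_of_type_algebra\<lparr>carrier := C\<rparr>\<^esub> a \<in> M" by simp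
  qed (use M in \<open>auto simp: ring_of_type_algebra_def\<close>)
  show "x \<otimes>\<^bsub>ring_of_type_algebra\<lparr>carrier := C\<rparr>\<^esub> a \<in> M" "a \<otimes>\<^bsub>ring_of_type_algebra\<lparr>carrier := C\<rparr>\<^esub> x \<in> M"
    if "a \<in> M" "x \<in> carrier (ring_of_type_algebra\<lparr>carrier := C\<rparr>)" for a x
    using M(4) M' that by (auto simp: ring_of_type_algebra_def)
qed

lemma ideal_restrict_carrierD:
  fixes C M :: "'a::comm_ring_1 set"
  assumes "ideal M (ring_of_type_algebra\<lparr>carrier := C\<rparr>)"
  shows "0 \<in> M" "x \<in> M \<Longrightarrow> y \<in> M \<Longrightarrow> x + y \<in> M" "q \<in> C \<Longrightarrow> x \<in> M \<Longrightarrow> q * x \<in> M"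
proof -
  interpret ideal M "ring_of_type_algebra\<lparr>carrier := C\<rparr>" by (rule assms)
  show "0 \<in> M" "x \<in> M \<Longrightarrow> y \<in> M \<Longrightarrow> x + y \<in> M" "q \<in> C \<Longrightarrow> x \<in> M \<Longrightarrow> q * x \<in> M"
    using additive_subgroup.zero_closed[OF ideal.axioms(1)[OF assms]]
      additive_subgroup.a_closed[OF ideal.axioms(1)[OF assms], of x y] I_l_closed[of x q]
    by (auto simp: ring_of_type_algebra_def)
qed

lemma mpoly_ring_restrict: "mpoly_ring = ring_of_type_algebra\<lparr>carrier := UNIV\<rparr>"
  by (simp add: mpoly_ring_def ring_of_type_algebra_def)

lemma degree_zero_ring_restrict:
  "degree_zero_ring W = ring_of_type_algebra\<lparr>carrier := homog_component W 0\<rparr>"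
  by (simp add: degree_zero_ring_def mpoly_ring_def)

lemma ring_mpoly_ring: "ring mpoly_ring"
  unfolding mpoly_ring_restrict by (rule ring_restrict_carrier) auto

subsection \<open>Weighted degrees\<close>

lemma wdeg_0 [simp]: "wdeg W 0 = 0"
  by (simp add: wdeg_def)

lemma wdeg_add [simp]: "wdeg W (s + t) = wdeg W s + wdeg W t"
  by (simp add: wdeg_def lookup_add algebra_simps sum.distrib)

lemma wdeg_single [simp]: "wdeg W (Poly_Mapping.single i k) = W i * int k"
proof -
  have "wdeg W (Poly_Mapping.single i k) = (\<Sum>j\<in>UNIV. if j = i then W i * int k else 0)"
    unfolding wdeg_def by (rule sum.cong) (auto simp: lookup_single when_def)
  then show ?thesis by simp
qed

lemma wdeg_nonneg: "\<forall>i. 0 \<le> W i \<Longrightarrow> 0 \<le> wdeg W t"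
  by (simp add: wdeg_def sum_nonneg)

lemma lookup_posE:
  fixes t :: "'n \<Rightarrow>\<^sub>0 nat"
  assumes "Poly_Mapping.lookup t i \<noteq> 0"
  obtains s where "t = s + Poly_Mapping.single i 1"
proof
  show "t = (t - Poly_Mapping.single i 1) + Poly_Mapping.single i 1"
    by (rule poly_mapping_eqI) (use assms in \<open>auto simp: lookup_add lookup_minus lookup_single when_def\<close>)
qed

lemma homog_component_lookup_eq_0:
  "f \<in> homog_component W d \<Longrightarrow> wdeg W t \<noteq> d \<Longrightarrow> Poly_Mapping.lookup f t = 0"
  by (auto simp: homog_component_def in_keys_iff)

lemma homog_component_zero [simp]: "0 \<in> homog_component W d"
  by (simp add: homog_component_def)

lemma homog_component_add:
  "f \<in> homog_component W d \<Longrightarrow> g \<in> homog_component W d \<Longrightarrow> f + g \<in> homog_component W d"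
  using keys_add[of f g] by (auto simp: homog_component_def)

lemma homog_component_uminus: "f \<in> homog_component W d \<Longrightarrow> - f \<in> homog_component W d"
  by (auto simp: homog_component_def in_keys_iff)

lemma homog_component_mult:
  "f \<in> homog_component W d \<Longrightarrow> g \<in> homog_component W e \<Longrightarrow> f * g \<in> homog_component W (d + e)"
  using keys_mult[of f g] by (fastforce simp: homog_component_def)

lemma one_homog_component: "1 \<in> homog_component W 0"
  by (simp add: homog_component_def)

lemma ring_degree_zero_ring: "ring (degree_zero_ring W)"
  unfolding degree_zero_ring_restrict
  using homog_component_mult[of _ W 0 _ 0]
  by (intro ring_restrict_carrier) (auto intro: homog_component_add homog_component_uminus one_homog_component)

subsection \<open>Polynomials not involving an indeterminate\<close>

lemma lookup_single_mult:
  fixes f :: "('a::cancel_comm_monoid_add) \<Rightarrow>\<^sub>0 'k::comm_ring_1"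
  shows "Poly_Mapping.lookup (Poly_Mapping.single t a * f) (t + s) = a * Poly_Mapping.lookup f s"
  by (simp add: lookup_mult lookup_single when_mult)

lemma lookup_single_mult_eq_0:
  fixes f :: "('a::cancel_comm_monoid_add) \<Rightarrow>\<^sub>0 'k::comm_ring_1"
  assumes "\<And>s. u \<noteq> t + s"
  shows "Poly_Mapping.lookup (Poly_Mapping.single t a * f) u = 0"
  using keys_mult[of "Poly_Mapping.single t a" f] assms by (fastforce simp: in_keys_iff split: if_splits)

lemma lookup_mult_indet:
  "Poly_Mapping.lookup (f * indet i) (s + Poly_Mapping.single i 1) = Poly_Mapping.lookup f s"
  using lookup_single_mult[of "Poly_Mapping.single i 1" 1 f s]
  by (simp add: indet_def ac_simps)

text \<open>Translates divisibility of power products into exponent vectors: a key of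
  \<open>indet i * q\<close> is the exponent of x_i plus a key of \<open>q\<close>.\<close>

lemma indet_dvd_single_iff:
  "(indet i :: ('n, 'k::comm_ring_1) mpoly) dvd Poly_Mapping.single t 1 \<longleftrightarrow> Poly_Mapping.lookup t i \<noteq> 0"
proof
  assume "(indet i :: ('n, 'k) mpoly) dvd Poly_Mapping.single t 1"
  then obtain q :: "('n, 'k) mpoly" where q: "Poly_Mapping.single t 1 = indet i * q" by (elim dvdE)
  have "t \<in> Poly_Mapping.keys (indet i * q)"
    unfolding q[symmetric] by simp
  then show "Poly_Mapping.lookup t i \<noteq> 0"
    using keys_mult[of "indet i" q] by (auto simp: indet_def lookup_add)
next
  assume "Poly_Mapping.lookup t i \<noteq> 0"
  then obtain s where "t = s + Poly_Mapping.single i 1" by (rule lookup_posE)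
  then have "Poly_Mapping.single t (1::'k) = indet i * Poly_Mapping.single s 1"
    by (simp add: indet_def mult_single ac_simps)
  then show "(indet i :: ('n, 'k) mpoly) dvd Poly_Mapping.single t 1" by simp
qed

lemma indet_free_keys: "indet_free i h \<longleftrightarrow> (\<forall>t\<in>Poly_Mapping.keys h. Poly_Mapping.lookup t i = 0)"
  by (simp add: indet_free_def indet_dvd_single_iff)

text \<open>This form is a system of linear conditions on the coefficients of \<open>h\<close>, so
  it passes to sums and negatives at once and matches the coefficients read by
  \<open>zero_coeff\<close>.\<close>

lemma indet_free_iff:
  "indet_free i h \<longleftrightarrow> (\<forall>s. Poly_Mapping.lookup h (s + Poly_Mapping.single i 1) = 0)"
proof
  assume *: "indet_free i h"
  show "\<forall>s. Poly_Mapping.lookup h (s + Poly_Mapping.single i 1) = 0"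
  proof (intro allI, rule ccontr)
    fix s assume "Poly_Mapping.lookup h (s + Poly_Mapping.single i 1) \<noteq> 0"
    then have "s + Poly_Mapping.single i 1 \<in> Poly_Mapping.keys h" by (simp add: in_keys_iff)
    with * show False unfolding indet_free_keys by (fastforce simp: lookup_add)
  qed
next
  assume *: "\<forall>s. Poly_Mapping.lookup h (s + Poly_Mapping.single i 1) = 0"
  show "indet_free i h"
    unfolding indet_free_keys
  proof (intro ballI, rule ccontr)
    fix t assume t: "t \<in> Poly_Mapping.keys h" "Poly_Mapping.lookup t i \<noteq> 0"
    from t(2) obtain s where "t = s + Poly_Mapping.single i 1" by (rule lookup_posE)
    with t(1) * show False by (simp add: in_keys_iff)
  qed
qed

lemma indet_free_add: "indet_free i f \<Longrightarrow> indet_free i g \<Longrightarrow> indet_free i (f + g)"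
  by (simp add: indet_free_iff lookup_add)

lemma indet_free_mult: "indet_free i f \<Longrightarrow> indet_free i g \<Longrightarrow> indet_free i (f * g)"
  using keys_mult[of f g] by (fastforce simp: indet_free_keys lookup_add)

text \<open>A term containing x_i has degree at least \<open>W i\<close>, because its cofactor has
  nonnegative degree.\<close>

lemma degree_zero_indet_free:
  assumes "\<forall>i. 0 \<le> W i" "0 < W i" "q \<in> homog_component W 0"
  shows "indet_free i q"
  unfolding indet_free_keys
proof (intro ballI, rule ccontr)
  fix t assume t: "t \<in> Poly_Mapping.keys q" "Poly_Mapping.lookup t i \<noteq> 0"
  from t(2) obtain s where "t = s + Poly_Mapping.single i 1" by (rule lookup_posE)
  then show False
    using t(1) assms wdeg_nonneg[OF assms(1), of s] by (auto simp: homog_component_def)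
qed

subsection \<open>The coefficient of an indeterminate in degree zero\<close>

text \<open>This is the map \<phi>, given coefficientwise: shifting exponents by x_i amounts to
  dividing by x_i.\<close>

definition zero_coeff :: "('n::finite \<Rightarrow> int) \<Rightarrow> 'n \<Rightarrow> ('n, 'k::comm_ring_1) mpoly \<Rightarrow> ('n, 'k) mpoly" where
  "zero_coeff W i f = Abs_poly_mapping
    (\<lambda>s. if wdeg W s = 0 then Poly_Mapping.lookup f (s + Poly_Mapping.single i 1) else 0)"

text \<open>The support is finite because it lies in the preimage of the keys of \<open>f\<close>
  under an injective shift.\<close>

lemma lookup_zero_coeff:
  "Poly_Mapping.lookup (zero_coeff W i f) s =
    (if wdeg W s = 0 then Poly_Mapping.lookup f (s + Poly_Mapping.single i 1) else 0)"
proof -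
  have "finite ((\<lambda>s. s + Poly_Mapping.single i 1) -` Poly_Mapping.keys f)"
    by (rule finite_vimageI) (auto simp: inj_on_def)
  then have "finite {s. (if wdeg W s = 0 then Poly_Mapping.lookup f (s + Poly_Mapping.single i 1) else 0) \<noteq> 0}"
    by (rule rev_finite_subset) (auto simp: in_keys_iff)
  then show ?thesis
    unfolding zero_coeff_def by (subst Abs_poly_mapping_inverse) auto
qed

lemma zero_coeff_add: "zero_coeff W i (f + g) = zero_coeff W i f + zero_coeff W i g"
  by (rule poly_mapping_eqI) (simp add: lookup_zero_coeff lookup_add)

lemma zero_coeff_indet_free: "indet_free i h \<Longrightarrow> zero_coeff W i h = 0"
  by (rule poly_mapping_eqI) (simp add: lookup_zero_coeff indet_free_iff)

lemma zero_coeff_homog: "zero_coeff W i f \<in> homog_component W 0"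
  by (auto simp: homog_component_def in_keys_iff lookup_zero_coeff split: if_splits)

lemma zero_coeff_mult_indet: "c \<in> homog_component W 0 \<Longrightarrow> zero_coeff W i (c * indet i) = c"
  by (rule poly_mapping_eqI)
    (auto simp: lookup_zero_coeff lookup_mult_indet homog_component_def in_keys_iff simp del: One_nat_def)

lemma zero_coeff_separating:
  assumes "separating i f"
  shows "zero_coeff W i f = 1"
proof -
  obtain h where h: "indet_free i h" "f = indet i - h"
    using assms by (auto simp: separating_def)
  have "indet_free i (- h)" using h(1) by (simp add: indet_free_iff)
  \<comment> \<open>Reads \<open>f\<close> as a decomposition with coefficient 1, which \<phi>
    recovers.\<close>
  moreover have "f = 1 * indet i + (- h)" using h by simp
  ultimately show ?thesis
    using zero_coeff_mult_indet[OF one_homog_component]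
    by (simp only: zero_coeff_add zero_coeff_indet_free) simp
qed

lemma zero_coeff_decomposition:
  "is_decomposition W i f c h \<Longrightarrow> zero_coeff W i f = c"
  by (auto simp: is_decomposition_def zero_coeff_add zero_coeff_mult_indet zero_coeff_indet_free)

text \<open>\<phi> reads only terms s x_i with s of degree zero, and these have degree
  \<open>W i\<close>.\<close>

lemma zero_coeff_other_degree:
  assumes "f \<in> homog_component W d" "d \<noteq> W i"
  shows "zero_coeff W i f = 0"
  by (rule poly_mapping_eqI)
    (use assms in \<open>auto simp: lookup_zero_coeff intro!: homog_component_lookup_eq_0[OF assms(1)]\<close>)

text \<open>In degree \<open>W i\<close>, every term s x_i has s of degree zero, so \<phi> collects
  all terms divisible by x_i and the remainder is free of x_i.\<close>

lemma is_decomposition_zero_coeff: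
  assumes "f \<in> homog_component W (W i)"
  shows "is_decomposition W i f (zero_coeff W i f) (f - zero_coeff W i f * indet i)"
proof -
  have "Poly_Mapping.lookup f (s + Poly_Mapping.single i 1) = 0" if "wdeg W s \<noteq> 0" for s
    using that by (intro homog_component_lookup_eq_0[OF assms]) simp
  then have "indet_free i (f - zero_coeff W i f * indet i)"
    unfolding indet_free_iff lookup_minus lookup_mult_indet by (simp add: lookup_zero_coeff)
  then show ?thesis
    by (simp add: is_decomposition_def zero_coeff_homog)
qed

text \<open>The case of a monomial q in the rule \<phi> (q g) = q_0 \<phi> g; additivity of \<phi>
  takes care of general q.\<close>

lemma zero_coeff_single_mult:
  assumes W: "\<forall>i. 0 \<le> W i"
    and g: "\<And>t. wdeg W t = 0 \<Longrightarrow> Poly_Mapping.lookup g t = 0"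
  shows "zero_coeff W i (Poly_Mapping.single t a * g) =
    (if wdeg W t = 0 then Poly_Mapping.single t a * zero_coeff W i g else 0)"
proof (rule poly_mapping_eqI)
  fix s
  let ?e = "Poly_Mapping.single i (1::nat)"
  let ?l = "Poly_Mapping.lookup (zero_coeff W i (Poly_Mapping.single t a * g)) s"
  let ?r = "Poly_Mapping.lookup
    (if wdeg W t = 0 then Poly_Mapping.single t a * zero_coeff W i g else 0) s"
  show "?l = ?r"
  proof (cases "\<exists>v. s = t + v")
    case True
    then obtain v where s: "s = t + v" by blast
    have l: "Poly_Mapping.lookup (Poly_Mapping.single t a * g) (s + ?e) = a * Poly_Mapping.lookup g (v + ?e)"
      using lookup_single_mult[of t a g "v + ?e"] by (simp add: s ac_simps)
    \<comment> \<open>Nonnegative degrees add up to zero only if both vanish.\<close>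
    have "wdeg W s = 0 \<longleftrightarrow> wdeg W t = 0 \<and> wdeg W v = 0"
      using wdeg_nonneg[OF W, of t] wdeg_nonneg[OF W, of v] by (auto simp: s)
    then show ?thesis
      using lookup_single_mult[of t a "zero_coeff W i g" v] l
      by (auto simp: s lookup_zero_coeff simp del: One_nat_def)
  next
    case False
    have r: "?r = 0"
      using False lookup_single_mult_eq_0[of s t a "zero_coeff W i g"] by simp
    \<comment> \<open>Here \<open>t\<close> does not divide \<open>s\<close>. If it divides s x_i,
      then x_i must come from \<open>t\<close>, so the cofactor \<open>v\<close> divides
      \<open>s\<close> and has degree zero, where \<open>g\<close> has no term.\<close>
    have "Poly_Mapping.lookup (Poly_Mapping.single t a * g) (s + ?e) = 0" if s: "wdeg W s = 0"
    proof (cases "\<exists>v. s + ?e = t + v")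
      case True
      then obtain v where v: "s + ?e = t + v" by blast
      have "Poly_Mapping.lookup v i = 0"
      proof (rule ccontr)
        assume "Poly_Mapping.lookup v i \<noteq> 0"
        then obtain v' where "v = v' + ?e" by (rule lookup_posE)
        then have "s + ?e = (t + v') + ?e" using v by (simp add: ac_simps)
        then show False using False by (metis add_right_cancel)
      qed
      moreover have "Poly_Mapping.lookup (t + v) i \<noteq> 0"
        unfolding v[symmetric] by (simp add: lookup_add)
      ultimately have "Poly_Mapping.lookup t i \<noteq> 0" by (simp add: lookup_add)
      then obtain t' where "t = t' + ?e" by (rule lookup_posE)
      then have "s + ?e = (t' + v) + ?e" using v by (simp add: ac_simps)
      then have "s = t' + v" by (metis add_right_cancel)
      then have "wdeg W v = 0"
        using s wdeg_nonneg[OF W, of t'] wdeg_nonneg[OF W, of v] by simp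
      then show ?thesis by (simp add: v lookup_single_mult g del: One_nat_def)
    next
      case False
      then show ?thesis by (intro lookup_single_mult_eq_0) blast
    qed
    then have "?l = 0" unfolding lookup_zero_coeff by simp
    with r show ?thesis by simp
  qed
qed

text \<open>Updating at an exponent outside the support is adding a monomial. Closure under sums and
  monomial multiples thus gives closure under all multiples.\<close>

lemma mpoly_induct_single_add [case_names zero add]:
  fixes f :: "'a \<Rightarrow>\<^sub>0 'b::comm_monoid_add"
  assumes "P 0" "\<And>t a f. P f \<Longrightarrow> P (Poly_Mapping.single t a + f)"
  shows "P f"
proof (induction f rule: update_induct)
  case const
  show ?case by (rule assms(1))
next
  case (update f t a)
  have "Poly_Mapping.update t a f = Poly_Mapping.single t a + f"
    by (rule poly_mapping_eqI)
      (use update in \<open>auto simp: lookup_add lookup_update lookup_single when_def in_keys_iff\<close>)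
  then show ?case using assms(2)[OF update(3)] by simp
qed

subsection \<open>The criterion\<close>

text \<open>By minimality of the generated ideal, it suffices to find an ideal of P that contains
  all \<open>g j\<close> and that \<phi> maps into the ideal of the \<open>c j\<close>.\<close>

lemma zero_coeff_mem_Idl:
  assumes W: "\<forall>i. 0 \<le> W i"
    and g: "\<forall>j<r. g j \<in> homog_component W (d j) \<and> 0 < d j"
    and dec: "\<forall>j\<in>{j. j < r \<and> d j = W i}. is_decomposition W i (g j) (c j) (h j)"
    and f: "f \<in> Idl\<^bsub>mpoly_ring\<^esub> (g ` {..<r})"
  shows "zero_coeff W i f \<in> Idl\<^bsub>degree_zero_ring W\<^esub> (c ` {j. j < r \<and> d j = W i})"
proof -
  let ?J = "{j. j < r \<and> d j = W i}"
  define A where "A = Idl\<^bsub>degree_zero_ring W\<^esub> (c ` ?J)"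
  have c_sub: "c ` ?J \<subseteq> carrier (degree_zero_ring W)"
    using dec by (auto simp: is_decomposition_def degree_zero_ring_def)
  note idealA = ring.genideal_ideal[OF ring_degree_zero_ring c_sub, folded A_def]
  note A = ideal_restrict_carrierD[OF idealA[unfolded degree_zero_ring_restrict]]
  have c_A: "c ` ?J \<subseteq> A"
    unfolding A_def by (rule ring.genideal_self[OF ring_degree_zero_ring c_sub])
  \<comment> \<open>The second condition is what the multiplication rule for \<phi> demands of its
    right factor; building it into \<open>M\<close> carries it through products.\<close>
  define M where "M = {f. zero_coeff W i f \<in> A \<and> (\<forall>t. wdeg W t = 0 \<longrightarrow> Poly_Mapping.lookup f t = 0)}"
  have zero_M: "0 \<in> M"
    using A(1) by (simp add: M_def zero_coeff_indet_free indet_free_iff)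
  have add_M: "x + y \<in> M" if "x \<in> M" "y \<in> M" for x y
    using that A(2) by (auto simp: M_def zero_coeff_add lookup_add)
  have single_M: "Poly_Mapping.single t a * x \<in> M" if x: "x \<in> M" for t a x
  proof -
    have "Poly_Mapping.lookup (Poly_Mapping.single t a * x) s = 0" if "wdeg W s = 0" for s
    proof (cases "\<exists>v. s = t + v")
      case True
      then obtain v where s: "s = t + v" by blast
      then have "wdeg W v = 0"
        using that wdeg_nonneg[OF W, of t] wdeg_nonneg[OF W, of v] by simp
      then show ?thesis using x by (simp add: s lookup_single_mult M_def)
    next
      case False
      then show ?thesis by (intro lookup_single_mult_eq_0) blast
    qed
    moreover have "zero_coeff W i (Poly_Mapping.single t a * x) \<in> A"
    proof -
      \<comment> \<open>Either the monomial lies in P_0 and is absorbed by \<open>A\<close>, or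
        \<phi> sends the product to 0.\<close>
      have "Poly_Mapping.single t a \<in> homog_component W 0" if "wdeg W t = 0"
        using that by (simp add: homog_component_def)
      then show ?thesis
        using x A(1) A(3) by (subst zero_coeff_single_mult[OF W]) (auto simp: M_def)
    qed
    ultimately show ?thesis by (simp add: M_def)
  qed
  have mult_M: "q * x \<in> M" if "x \<in> M" for q x
    by (induction q rule: mpoly_induct_single_add)
      (use that in \<open>auto simp: zero_M distrib_right intro: add_M single_M\<close>)
  have "ideal M mpoly_ring"
    unfolding mpoly_ring_restrict
    by (rule ideal_restrict_carrierI)
      (use ring_mpoly_ring zero_M add_M mult_M in \<open>auto simp: mpoly_ring_restrict\<close>)
  moreover have "g ` {..<r} \<subseteq> M"
  proof clarify
    fix j assume j: "j < r"
    then have gj: "g j \<in> homog_component W (d j)" "0 < d j" using g by auto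
    have "zero_coeff W i (g j) \<in> A"
    proof (cases "d j = W i")
      case True
      then show ?thesis
        using j dec c_A zero_coeff_decomposition[of W i "g j" "c j" "h j"] by auto
    next
      case False
      then show ?thesis
        using zero_coeff_other_degree[OF gj(1)] A(1) by simp
    qed
    \<comment> \<open>Positivity of \<open>d j\<close> excludes terms of degree zero.\<close>
    then show "g j \<in> M"
      using gj(2) by (auto simp: M_def intro!: homog_component_lookup_eq_0[OF gj(1)])
  qed
  ultimately have "Idl\<^bsub>mpoly_ring\<^esub> (g ` {..<r}) \<subseteq> M"
    by (rule ring.genideal_minimal[OF ring_mpoly_ring])
  then show ?thesis using f by (auto simp: M_def A_def)
qed

text \<open>The elements of P_0 occurring as coefficient of x_i in a member of \<open>I\<close> of
  degree \<open>W i\<close> form the ideal \<open>N\<close> of P_0 when \<open>W i\<close> is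
  positive. It contains every \<open>c j\<close>, hence 1.\<close>

lemma separating_in_Idl:
  fixes g :: "nat \<Rightarrow> ('n::finite, 'k::comm_ring_1) mpoly"
  assumes W: "\<forall>i. 0 \<le> W i"
    and g: "\<forall>j<r. g j \<in> homog_component W (d j) \<and> 0 < d j"
    and dec: "\<forall>j\<in>{j. j < r \<and> d j = W i}. is_decomposition W i (g j) (c j) (h j)"
    and one: "1 \<in> Idl\<^bsub>degree_zero_ring W\<^esub> (c ` {j. j < r \<and> d j = W i})"
  shows "\<exists>f\<in>Idl\<^bsub>mpoly_ring\<^esub> (g ` {..<r}). separating i f \<and> homogeneous W f"
proof -
  let ?J = "{j. j < r \<and> d j = W i}"
  define I where "I = Idl\<^bsub>mpoly_ring\<^esub> (g ` {..<r})"
  have g_sub: "g ` {..<r} \<subseteq> carrier mpoly_ring"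
    by (simp add: mpoly_ring_restrict)
  note idealI = ring.genideal_ideal[OF ring_mpoly_ring g_sub, folded I_def]
  note I = ideal_restrict_carrierD[OF idealI[unfolded mpoly_ring_restrict]]
  have g_I: "g ` {..<r} \<subseteq> I"
    unfolding I_def by (rule ring.genideal_self[OF ring_mpoly_ring g_sub])
  \<comment> \<open>The first conjunct covers \<open>W i = 0\<close>, where \<open>?J\<close> is empty and elements of \<open>P_0\<close> may involve \<open>x_i\<close>.\<close>
  define N where "N = {a \<in> homog_component W 0. (W i = 0 \<longrightarrow> a = 0) \<and>
    (\<exists>f\<in>I. f \<in> homog_component W (W i) \<and> indet_free i (f - a * indet i))}"
  have "ideal N (degree_zero_ring W)"
    unfolding degree_zero_ring_restrict
  proof (rule ideal_restrict_carrierI)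
    show "ring (ring_of_type_algebra\<lparr>carrier := homog_component W 0\<rparr>)"
      using ring_degree_zero_ring by (simp add: degree_zero_ring_restrict)
    show "- 1 \<in> homog_component W 0"
      by (intro homog_component_uminus one_homog_component)
    show "N \<subseteq> homog_component W 0" by (auto simp: N_def)
    show "0 \<in> N"
      using I(1) by (auto simp: N_def indet_free_def intro!: bexI[of _ 0])
    show "a + b \<in> N" if ab: "a \<in> N" "b \<in> N" for a b
    proof -
      from ab obtain f f' where f: "f \<in> I" "f \<in> homog_component W (W i)" "indet_free i (f - a * indet i)"
        and f': "f' \<in> I" "f' \<in> homog_component W (W i)" "indet_free i (f' - b * indet i)"
        by (auto simp: N_def)
      have "f + f' - (a + b) * indet i = (f - a * indet i) + (f' - b * indet i)"
        by (simp add: algebra_simps)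
      then have "indet_free i (f + f' - (a + b) * indet i)"
        using indet_free_add[OF f(3) f'(3)] by (simp only:)
      then show ?thesis
        using ab I(2)[OF f(1) f'(1)] homog_component_add[OF f(2) f'(2)]
        by (auto simp: N_def intro: homog_component_add)
    qed
    show "q * a \<in> N" if q: "q \<in> homog_component W 0" and a: "a \<in> N" for q a
    proof (cases "W i = 0")
      case True
      then show ?thesis using a \<open>0 \<in> N\<close> by (auto simp: N_def)
    next
      case False
      then have pos: "0 < W i" using W by (simp add: order_less_le)
      from a obtain f where f: "f \<in> I" "f \<in> homog_component W (W i)" "indet_free i (f - a * indet i)"
        by (auto simp: N_def)
      \<comment> \<open>As \<open>W i\<close> is positive, \<open>q\<close> is free of x_i, so
        multiplying by it keeps the remainder free of x_i.\<close>
      have "q * f - q * a * indet i = q * (f - a * indet i)"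
        by (simp add: algebra_simps)
      then have "indet_free i (q * f - q * a * indet i)"
        using indet_free_mult[OF degree_zero_indet_free[OF W pos q] f(3)] by simp
      moreover have "q * f \<in> I" using I(3)[OF UNIV_I f(1)] .
      moreover have "q * f \<in> homog_component W (W i)" "q * a \<in> homog_component W 0"
        using homog_component_mult[OF q f(2)] homog_component_mult[OF q, of a 0] a
        by (auto simp: N_def)
      ultimately show ?thesis using False by (auto simp: N_def)
    qed
  qed
  moreover have "c ` ?J \<subseteq> N"
  proof clarify
    fix j assume j: "j < r" "d j = W i"
    then have "is_decomposition W i (g j) (c j) (h j)" using dec by simp
    \<comment> \<open>\<open>W i\<close> equals the positive degree \<open>d j\<close>; the witness
      for \<open>c j\<close> is \<open>g j\<close>, with remainder \<open>h j\<close>.\<close>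
    moreover have "g j \<in> I" "g j \<in> homog_component W (W i)" "W i \<noteq> 0"
      using g_I g j by auto
    ultimately show "c j \<in> N"
      by (auto simp: N_def is_decomposition_def intro!: bexI[of _ "g j"])
  qed
  ultimately have "Idl\<^bsub>degree_zero_ring W\<^esub> (c ` ?J) \<subseteq> N"
    by (rule ring.genideal_minimal[OF ring_degree_zero_ring])
  \<comment> \<open>This unfolds membership of 1 in \<open>N\<close>.\<close>
  then obtain f where f: "f \<in> I" "f \<in> homog_component W (W i)" "indet_free i (f - indet i)"
    using one by (auto simp: N_def)
  have "indet_free i (indet i - f)"
    using f(3) by (simp add: indet_free_iff lookup_minus)
  then have "separating i f"
    unfolding separating_def by (intro exI[of _ "indet i - f"]) simp
  then show ?thesis
    using f by (auto simp: I_def homogeneous_def)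
qed

text \<open>The degrees \<open>d j\<close> are given separately because a zero generator is
  homogeneous of every degree. The first conjunct guarantees that the decompositions assumed in the
  other two exist. The linear order on the indices turns the collected indeterminates into a
  tuple.\<close>

theorem mainTheorem4:
  fixes W :: "'n::{finite,linorder} \<Rightarrow> int"
    and r :: nat
    and g :: "nat \<Rightarrow> ('n, 'k::field) mpoly"
    and d :: "nat \<Rightarrow> int"
    and I :: "('n, 'k) mpoly set"
    and J :: "'n \<Rightarrow> nat set"
  assumes W_nonneg: "\<forall>i. 0 \<le> W i"
    and g_homog: "\<forall>j<r. g j \<in> homog_component W (d j) \<and> 0 < d j"
    and I_eq: "I = Idl\<^bsub>mpoly_ring\<^esub> (g ` {..<r})"
    and J_eq: "J = (\<lambda>i. {j. j < r \<and> d j = W i})"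
  shows "(\<forall>i. \<forall>j\<in>J i. \<exists>c h. is_decomposition W i (g j) c h) \<and>
    (\<forall>i c h. (\<forall>j\<in>J i. is_decomposition W i (g j) (c j) (h j)) \<longrightarrow>
      ((\<exists>f\<in>I. separating i f \<and> homogeneous W f) \<longleftrightarrow> 1 \<in> Idl\<^bsub>degree_zero_ring W\<^esub> (c ` J i))) \<and>
    (\<forall>c h Z. (\<forall>i. \<forall>j\<in>J i. is_decomposition W i (g j) (c i j) (h i j)) \<longrightarrow>
      Z = map indet (filter (\<lambda>i. 1 \<in> Idl\<^bsub>degree_zero_ring W\<^esub> (c i ` J i)) (sorted_list_of_set UNIV)) \<longrightarrow>
      Z = (map indet (filter (\<lambda>i. \<exists>f\<in>I. separating i f \<and> homogeneous W f) (sorted_list_of_set UNIV))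
            :: ('n, 'k) mpoly list))"
proof -
  have decomposable: "\<exists>c h. is_decomposition W i (g j) c h" if "j \<in> J i" for i j
  proof -
    have "g j \<in> homog_component W (W i)" using that g_homog by (auto simp: J_eq)
    then show ?thesis using is_decomposition_zero_coeff by blast
  qed
  have criterion: "(\<exists>f\<in>I. separating i f \<and> homogeneous W f) \<longleftrightarrow> 1 \<in> Idl\<^bsub>degree_zero_ring W\<^esub> (c ` J i)"
    if dec: "\<forall>j\<in>J i. is_decomposition W i (g j) (c j) (h j)" for i c h
  proof
    assume "\<exists>f\<in>I. separating i f \<and> homogeneous W f"
    then obtain f where "f \<in> I" "separating i f" by blast
    then show "1 \<in> Idl\<^bsub>degree_zero_ring W\<^esub> (c ` J i)"
      using zero_coeff_mem_Idl[OF W_nonneg g_homog, of i c h f] dec zero_coeff_separating[of i f W]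
      by (simp add: I_eq J_eq)
  next
    assume "1 \<in> Idl\<^bsub>degree_zero_ring W\<^esub> (c ` J i)"
    then show "\<exists>f\<in>I. separating i f \<and> homogeneous W f"
      using separating_in_Idl[OF W_nonneg g_homog, of i c h] dec by (simp add: I_eq J_eq)
  qed
  have "map indet (filter (\<lambda>i. 1 \<in> Idl\<^bsub>degree_zero_ring W\<^esub> (c i ` J i)) (sorted_list_of_set UNIV)) =
      (map indet (filter (\<lambda>i. \<exists>f\<in>I. separating i f \<and> homogeneous W f) (sorted_list_of_set UNIV))
        :: ('n, 'k) mpoly list)"
    if "\<forall>i. \<forall>j\<in>J i. is_decomposition W i (g j) (c i j) (h i j)" for c h
  proof -
    have "1 \<in> Idl\<^bsub>degree_zero_ring W\<^esub> (c i ` J i) \<longleftrightarrow> (\<exists>f\<in>I. separating i f \<and> homogeneous W f)" for i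
      using criterion[of i "c i" "h i"] that by blast
    then show ?thesis by simp
  qed
  with decomposable criterion show ?thesis by blast
qed

end
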